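(* Let $X$ be a bounded lattice. If the ring $\mathbb{Z}[X]/I$ is Noetherian (this is the case, for example, when $X$ is finite), then there exists an integer $0\le n<\infty$ such that \[ \mathbb{Z}[X]/I\cong\mathbb{Z}^n \] as rings, where $\mathbb{Z}^n$ has coordinatewise operations and $\mathbb{Z}^0$ is the zero ring.
   Context: All rings are commutative with identity. A bounded lattice $X$ has a least element $0_X$ and a greatest element $1_X$. $\mathbb{Z}[X]$ is the polynomial ring with one variable for each element of $X$, and $I\subseteq\mathbb{Z}[X]$ is the ideal generated by $0_X$, $1_X-1$, and $x\wedge y-xy$, $x\vee y-x-y+xy$ for all $x,y\in X$. *)

theory Defs
  imports "HOL-Library.Poly_Mapping" "HOL-Algebra.Chinese_Remainder"
    "HOL-Algebra.IntRing" "HOL-Algebra.Ring_Divisibility"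
begin

text \<open>
  A polynomial sends each monomial to its coefficient, where a monomial is a finitely supported
  exponent function; the product from \<^theory>\<open>HOL-Library.Poly_Mapping\<close> is the convolution
  product, that is, multiplication of polynomials.
\<close>

type_synonym 'x int_mpoly = "('x \<Rightarrow>\<^sub>0 nat) \<Rightarrow>\<^sub>0 int"

definition int_mpoly_ring :: "'x int_mpoly ring" where
  "int_mpoly_ring = \<lparr>carrier = UNIV, monoid.mult = (*), one = 1, zero = 0, add = (+)\<rparr>"

definition Var :: "'x \<Rightarrow> 'x int_mpoly" where
  "Var x = Poly_Mapping.single (Poly_Mapping.single x 1) 1"

text \<open>
  The operations of the type class are written with qualified names, because
  \<^theory>\<open>HOL-Algebra.Lattice\<close> introduces constants of the same names for its lattice records.
\<close>

definition lattice_ideal :: "'x::bounded_lattice int_mpoly set" where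
  "lattice_ideal = Idl\<^bsub>int_mpoly_ring\<^esub>
     ({Var bot_class.bot, Var top_class.top - 1}
      \<union> {Var (inf_class.inf x y) - Var x * Var y | x y. True}
      \<union> {Var (sup_class.sup x y) - Var x - Var y + Var x * Var y | x y. True})"

definition int_power_ring :: "nat \<Rightarrow> int list ring" where
  "int_power_ring n = RDirProd_list (replicate n \<Z>)"

lemma cring_int_mpoly_ring: "cring int_mpoly_ring"
proof (rule cringI)
  show "abelian_group int_mpoly_ring"
  proof (rule abelian_groupI)
    fix p :: "'x int_mpoly"
    have "- p + p = 0" by (rule left_minus)
    then show "\<exists>q\<in>carrier int_mpoly_ring. q \<oplus>\<^bsub>int_mpoly_ring\<^esub> p = \<zero>\<^bsub>int_mpoly_ring\<^esub>"
      unfolding int_mpoly_ring_def by (simp, blast)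
  qed (auto simp: int_mpoly_ring_def algebra_simps)
  show "comm_monoid int_mpoly_ring"
    by (rule comm_monoidI) (auto simp: int_mpoly_ring_def algebra_simps)
qed (auto simp: int_mpoly_ring_def algebra_simps)

lemma carrier_int_power_ring: "carrier (int_power_ring n) = {as. length as = n}"
  unfolding int_power_ring_def
  by (auto dest: RDirProd_list_carrier_mem(1) intro: RDirProd_list_carrier_memI)

lemma one_int_power_ring: "\<one>\<^bsub>int_power_ring n\<^esub> = replicate n 1"
  unfolding int_power_ring_def RDirProd_list_one by (induction n) auto

lemma zero_int_power_ring: "\<zero>\<^bsub>int_power_ring n\<^esub> = replicate n 0"
  unfolding int_power_ring_def RDirProd_list_zero by (induction n) auto

lemma int_power_ring_Suc_ops:
  assumes "length as = n" "length bs = n"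
  shows "(a # as) \<otimes>\<^bsub>int_power_ring (Suc n)\<^esub> (b # bs) = (a * b) # (as \<otimes>\<^bsub>int_power_ring n\<^esub> bs)"
    and "(a # as) \<oplus>\<^bsub>int_power_ring (Suc n)\<^esub> (b # bs) = (a + b) # (as \<oplus>\<^bsub>int_power_ring n\<^esub> bs)"
proof -
  have hom: "(\<lambda>(a, as). a # as) \<in> ring_hom (RDirProd \<Z> (int_power_ring n)) (int_power_ring (Suc n))"
    unfolding int_power_ring_def using RDirProd_list_hom1[of \<Z> "replicate n \<Z>"] by simp
  have mem: "(a, as) \<in> carrier (RDirProd \<Z> (int_power_ring n))"
    "(b, bs) \<in> carrier (RDirProd \<Z> (int_power_ring n))"
    using assms by (auto simp: RDirProd_carrier carrier_int_power_ring)
  show "(a # as) \<otimes>\<^bsub>int_power_ring (Suc n)\<^esub> (b # bs) = (a * b) # (as \<otimes>\<^bsub>int_power_ring n\<^esub> bs)"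
    using ring_hom_mult[OF hom mem] by (simp add: RDirProd_def DirProd_def monoid.defs)
  show "(a # as) \<oplus>\<^bsub>int_power_ring (Suc n)\<^esub> (b # bs) = (a + b) # (as \<oplus>\<^bsub>int_power_ring n\<^esub> bs)"
    using ring_hom_add[OF hom mem] by (simp add: RDirProd_def DirProd_def monoid.defs)
qed

lemma int_power_ring_0_ops:
  "as \<otimes>\<^bsub>int_power_ring 0\<^esub> bs = []" "as \<oplus>\<^bsub>int_power_ring 0\<^esub> bs = []"
  by (auto simp: int_power_ring_def monoid.defs)

lemma int_power_ring_coordinatewise:
  assumes "length as = n" "length bs = n"
  shows "as \<otimes>\<^bsub>int_power_ring n\<^esub> bs = map2 (*) as bs"
    and "as \<oplus>\<^bsub>int_power_ring n\<^esub> bs = map2 (+) as bs"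
  using assms
  by (induction n arbitrary: as bs)
     (auto simp: int_power_ring_0_ops int_power_ring_Suc_ops length_Suc_conv)

end

theory Submission
  imports Defs
begin

text \<open>
  In the quotient ring \<open>Q\<close> the image \<open>gen x\<close> of every variable is idempotent. If \<open>Q\<close> is Noetherian
  (ascending chain condition on annihilators) or the lattice is finite, repeatedly splitting
  \<open>f = gen x * f + (f - gen x * f)\<close> terminates and writes \<open>1\<close> as a finite sum of nonzero orthogonal
  idempotents \<open>f\<close> with \<open>gen x * f \<in> {0, f}\<close> for all \<open>x\<close>. For such an \<open>f\<close>, the map sending \<open>x\<close> to
  \<open>1\<close> if \<open>gen x * f = f\<close> and to \<open>0\<close> otherwise is a lattice homomorphism, so the presentation of \<open>Q\<close>
  extends it to a ring homomorphism \<open>\<chi>\<^sub>f : Q \<rightarrow> \<int>\<close>, and \<open>q * f = \<chi>\<^sub>f q * f\<close> for all \<open>q\<close>. Hence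
  \<open>\<chi>\<^sub>f f = 1\<close>, which rules out torsion, and the \<open>\<chi>\<^sub>f\<close> are the coordinates of an isomorphism from
  \<open>Q\<close> to a power of \<open>\<int>\<close>. Conversely, such a decomposition shows that every ideal is generated by
  one integer multiple of each \<open>f\<close>.
\<close>

subsection \<open>Noetherian rings\<close>

text \<open>The ascending chain condition in a form fit for well-founded induction: larger ideals
  count as smaller, and the union of an infinite ascending sequence would have to be one of its
  members.\<close>

lemma (in noetherian_ring) wf_ideals_supset:
  "wf {(J, K). ideal J R \<and> ideal K R \<and> K \<subset> J}"
  unfolding wf_iff_no_infinite_down_chain
proof
  assume "\<exists>s. \<forall>i. (s (Suc i), s i) \<in> {(J, K). ideal J R \<and> ideal K R \<and> K \<subset> J}"
  then obtain s where s: "\<And>i. ideal (s i) R" "\<And>i. s i \<subset> s (Suc i)"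
    by blast
  have "s i \<subseteq> s j" if "i \<le> j" for i j
    using lift_Suc_mono_le[of s i j] s(2) that by blast
  then have "s i \<subseteq> s j \<or> s j \<subseteq> s i" for i j
    using nat_le_linear by blast
  then have "subset.chain {I. ideal I R} (range s)"
    using s(1) unfolding pred_on.chain_def by blast
  then have "\<Union>(range s) \<in> range s"
    by (intro ideal_chain_is_trivial) auto
  then obtain k where "\<Union>(range s) = s k"
    by blast
  then show False
    using s(2)[of k] by blast
qed

text \<open>The preimage of an ideal is finitely generated, and by surjectivity the images of its
  generators generate the ideal.\<close>

lemma (in ring_hom_ring) noetherian_surj_image:
  assumes "noetherian_ring R" "h ` carrier R = carrier S"
  shows "noetherian_ring S"
proof (rule ring.noetherian_ringI)
  show "ring S" ..
  fix J assume J: "ideal J S"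
  define K where "K = {r \<in> carrier R. h r \<in> J}"
  have "ideal K R"
    unfolding K_def by (rule ideal_vimage[OF J])
  then obtain A where A: "A \<subseteq> carrier R" "finite A" "K = Idl A"
    using noetherian_ring.finetely_gen[OF assms(1)] by blast
  have AK: "A \<subseteq> K"
    using A R.genideal_self by simp
  have hA: "h ` A \<subseteq> carrier S"
    using A(1) by auto
  have "ideal {r \<in> carrier R. h r \<in> Idl\<^bsub>S\<^esub> (h ` A)} R"
    by (rule ideal_vimage[OF S.genideal_ideal[OF hA]])
  moreover have "A \<subseteq> {r \<in> carrier R. h r \<in> Idl\<^bsub>S\<^esub> (h ` A)}"
    using A(1) S.genideal_self[OF hA] by auto
  ultimately have KS: "K \<subseteq> {r \<in> carrier R. h r \<in> Idl\<^bsub>S\<^esub> (h ` A)}"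
    unfolding A(3) by (rule R.genideal_minimal)
  have "J \<subseteq> Idl\<^bsub>S\<^esub> (h ` A)"
  proof
    fix y assume "y \<in> J"
    moreover from this obtain x where "x \<in> carrier R" "y = h x"
      using assms(2) ideal.Icarr[OF J] by blast
    ultimately show "y \<in> Idl\<^bsub>S\<^esub> (h ` A)"
      using KS unfolding K_def by blast
  qed
  moreover have "Idl\<^bsub>S\<^esub> (h ` A) \<subseteq> J"
    using AK by (intro S.genideal_minimal[OF J]) (auto simp: K_def)
  ultimately show "\<exists>B\<subseteq>carrier S. finite B \<and> J = Idl\<^bsub>S\<^esub> B"
    using hA A(2) by blast
qed

lemma noetherian_ring_iso:
  assumes "noetherian_ring R" "ring S" "R \<simeq> S"
  shows "noetherian_ring S"
proof -
  obtain h where h: "h \<in> ring_iso R S"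
    using assms(3) unfolding is_ring_iso_def by blast
  interpret ring_hom_ring R S h
    using assms h by (intro ring_hom_ringI2) (auto simp: noetherian_ring_def ring_iso_def)
  show ?thesis
    using assms(1) h by (intro noetherian_surj_image) (auto simp: ring_iso_def bij_betw_def)
qed

text \<open>Division with remainder by a nonzero element of least absolute value.\<close>

lemma int_ideal_principal:
  fixes K :: "int set"
  assumes zero: "0 \<in> K" and diff: "\<And>a b. a \<in> K \<Longrightarrow> b \<in> K \<Longrightarrow> a - b \<in> K"
    and mult: "\<And>a c. a \<in> K \<Longrightarrow> c * a \<in> K"
  obtains d where "d \<in> K" "\<And>k. k \<in> K \<Longrightarrow> d dvd k"
proof (cases "K = {0}")
  case True
  then show ?thesis using that[of 0] by simp
next
  case False
  then obtain a where "a \<in> K - {0}"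
    using zero by blast
  then obtain d where d: "d \<in> K - {0}" "\<And>b. b \<in> K - {0} \<Longrightarrow> nat \<bar>d\<bar> \<le> nat \<bar>b\<bar>"
    using ex_has_least_nat[of "\<lambda>x. x \<in> K - {0}" a "\<lambda>x. nat \<bar>x\<bar>"] by blast
  show ?thesis
  proof (rule that)
    fix k assume "k \<in> K"
    then have "k mod d \<in> K"
      using diff[OF \<open>k \<in> K\<close> mult[of d "k div d"]] d(1) by (simp add: minus_div_mult_eq_mod)
    moreover have "nat \<bar>k mod d\<bar> < nat \<bar>d\<bar>"
      using d(1) by (simp add: abs_mod_less)
    ultimately show "d dvd k"
      using d(2) by (force simp: dvd_eq_mod_eq_0)
  qed (use d in auto)
qed

subsection \<open>Evaluation of polynomials at \<open>0\<close>-\<open>1\<close>-valued points\<close>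

text \<open>The inner induction on the exponent unpacks the power of a variable that
  \<open>update_induct\<close> inserts at once.\<close>

lemma monomial_induct [case_names zero Var]:
  fixes m :: "'x \<Rightarrow>\<^sub>0 nat"
  assumes "P 0" and step: "\<And>x m. P m \<Longrightarrow> P (Poly_Mapping.single x 1 + m)"
  shows "P m"
proof (induction m rule: Poly_Mapping.update_induct)
  case (update f a b)
  have "P (Poly_Mapping.single a k + f)" for k
  proof (induction k)
    case (Suc k)
    have "Poly_Mapping.single a (Suc k) = Poly_Mapping.single a 1 + Poly_Mapping.single a k"
      by (simp add: single_add[symmetric])
    then show ?case
      using step[OF Suc] by (simp add: add.assoc)
  qed (use update in simp)
  \<comment> \<open>Updating agrees with adding because \<open>a\<close> lies outside the support of
    \<open>f\<close>.\<close>
  moreover have "Poly_Mapping.update a b f = Poly_Mapping.single a b + f"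
    using update(1)
    by (intro poly_mapping_eqI) (auto simp: lookup_update lookup_add lookup_single in_keys_iff when_def)
  ultimately show ?case
    by simp
qed (rule assms(1))

text \<open>This is evaluation at the 0-1 vector given by \<open>\<phi>\<close>: positive powers of
  0 and 1 do not depend on the exponent.\<close>

definition monomial_val :: "('x \<Rightarrow> bool) \<Rightarrow> ('x \<Rightarrow>\<^sub>0 nat) \<Rightarrow> int" where
  "monomial_val \<phi> m = of_bool (\<forall>x\<in>Poly_Mapping.keys m. \<phi> x)"

definition mpoly_val :: "('x \<Rightarrow> bool) \<Rightarrow> 'x int_mpoly \<Rightarrow> int" where
  "mpoly_val \<phi> p = (\<Sum>m\<in>Poly_Mapping.keys p. Poly_Mapping.lookup p m * monomial_val \<phi> m)"

lemma monomial_val_add: "monomial_val \<phi> (m + n) = monomial_val \<phi> m * monomial_val \<phi> n"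
proof -
  have "Poly_Mapping.keys (m + n) = Poly_Mapping.keys m \<union> Poly_Mapping.keys n"
    by (auto simp: in_keys_iff lookup_add)
  then show ?thesis
    by (auto simp: monomial_val_def)
qed

lemma mpoly_val_0 [simp]: "mpoly_val \<phi> 0 = 0"
  by (simp add: mpoly_val_def)

lemma mpoly_val_frag_of [simp]: "mpoly_val \<phi> (frag_of m) = monomial_val \<phi> m"
  by (simp add: mpoly_val_def)

lemma mpoly_val_1 [simp]: "mpoly_val \<phi> 1 = 1"
  by (simp add: mpoly_val_frag_of[of _ 0, simplified] monomial_val_def flip: single_one)

lemma mpoly_val_Var [simp]: "mpoly_val \<phi> (Var x) = of_bool (\<phi> x)"
  by (simp add: Var_def monomial_val_def)

lemma mpoly_val_add [simp]: "mpoly_val \<phi> (p + q) = mpoly_val \<phi> p + mpoly_val \<phi> q"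
  unfolding mpoly_val_def
  by (rule setsum_keys_plus_distrib) (simp_all add: algebra_simps)

lemma mpoly_val_minus [simp]: "mpoly_val \<phi> (- p) = - mpoly_val \<phi> p"
  using mpoly_val_add[of \<phi> p "- p"] by simp

lemma mpoly_val_diff [simp]: "mpoly_val \<phi> (p - q) = mpoly_val \<phi> p - mpoly_val \<phi> q"
  using mpoly_val_add[of \<phi> p "- q"] by simp

text \<open>Integer polynomials form the free abelian group on the monomials, so
  \<open>frag_induction\<close> in each factor reduces the claim to two monomials.\<close>

lemma mpoly_val_mult [simp]: "mpoly_val \<phi> (p * q) = mpoly_val \<phi> p * mpoly_val \<phi> q"
  using subset_UNIV
proof (induction p rule: frag_induction)
  case (one m)
  show ?case
    using subset_UNIV
    by (induction q rule: frag_induction)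
       (simp_all add: mult_single monomial_val_add algebra_simps)
qed (simp_all add: algebra_simps)

lemma mpoly_val_of_int [simp]: "mpoly_val \<phi> (of_int k) = k"
proof -
  have "mpoly_val \<phi> (of_nat n) = int n" for n
    by (induction n) simp_all
  then show ?thesis
    by (cases k) (simp_all flip: of_nat_Suc)
qed

subsection \<open>The quotient ring as a type\<close>

lemma ideal_lattice_ideal: "ideal lattice_ideal int_mpoly_ring"
  unfolding lattice_ideal_def
  by (intro ring.genideal_ideal cring.axioms(1) cring_int_mpoly_ring) (simp add: int_mpoly_ring_def)

lemma lattice_ideal_0: "0 \<in> lattice_ideal"
  using additive_subgroup.zero_closed[OF ideal.axioms(1)[OF ideal_lattice_ideal]]
  by (simp add: int_mpoly_ring_def)

lemma lattice_ideal_add: "p \<in> lattice_ideal \<Longrightarrow> q \<in> lattice_ideal \<Longrightarrow> p + q \<in> lattice_ideal"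
  using additive_subgroup.a_closed[OF ideal.axioms(1)[OF ideal_lattice_ideal]]
  by (simp add: int_mpoly_ring_def)

lemma lattice_ideal_mult: "p \<in> lattice_ideal \<Longrightarrow> q * p \<in> lattice_ideal"
  using ideal.I_l_closed[OF ideal_lattice_ideal]
  by (simp add: int_mpoly_ring_def)

lemma lattice_ideal_minus: "p \<in> lattice_ideal \<Longrightarrow> - p \<in> lattice_ideal"
  using lattice_ideal_mult[of p "- 1"] by simp

lemma lattice_ideal_gens:
  fixes x y :: "'x::bounded_lattice"
  shows "Var bot_class.bot \<in> (lattice_ideal :: 'x int_mpoly set)"
    and "Var top_class.top - 1 \<in> (lattice_ideal :: 'x int_mpoly set)"
    and "Var (inf_class.inf x y) - Var x * Var y \<in> lattice_ideal"
    and "Var (sup_class.sup x y) - Var x - Var y + Var x * Var y \<in> lattice_ideal"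
proof -
  let ?G = "{Var bot_class.bot, Var top_class.top - 1}
      \<union> {Var (inf_class.inf x y) - Var x * Var y | x y. True}
      \<union> {Var (sup_class.sup x y) - Var x - Var y + Var x * Var y | x y. True} :: 'x int_mpoly set"
  have sub: "?G \<subseteq> lattice_ideal"
    unfolding lattice_ideal_def
    by (intro ring.genideal_self cring.axioms(1) cring_int_mpoly_ring) (simp add: int_mpoly_ring_def)
  show "Var bot_class.bot \<in> (lattice_ideal :: 'x int_mpoly set)"
    "Var top_class.top - 1 \<in> (lattice_ideal :: 'x int_mpoly set)"
    "Var (inf_class.inf x y) - Var x * Var y \<in> lattice_ideal"
    "Var (sup_class.sup x y) - Var x - Var y + Var x * Var y \<in> lattice_ideal"
    by (rule subsetD[OF sub], force)+
qed

text \<open>The value map is a ring homomorphism whose kernel contains all generators, hence the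
  ideal they generate.\<close>

lemma mpoly_val_lattice_ideal:
  assumes "\<not> \<phi> bot_class.bot" "\<phi> top_class.top"
    and "\<And>x y. \<phi> (inf_class.inf x y) \<longleftrightarrow> \<phi> x \<and> \<phi> y"
    and "\<And>x y. \<phi> (sup_class.sup x y) \<longleftrightarrow> \<phi> x \<or> \<phi> y"
    and "p \<in> lattice_ideal"
  shows "mpoly_val \<phi> p = 0"
proof -
  have "mpoly_val \<phi> \<in> ring_hom int_mpoly_ring \<Z>"
    by (rule ring_hom_memI) (simp_all add: int_mpoly_ring_def)
  then have "ring_hom_ring int_mpoly_ring \<Z> (mpoly_val \<phi>)"
    by (rule ring_hom_ringI2[OF cring.axioms(1)[OF cring_int_mpoly_ring] int.ring_axioms])
  then have "ideal (a_kernel int_mpoly_ring \<Z> (mpoly_val \<phi>)) int_mpoly_ring"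
    by (rule ring_hom_ring.kernel_is_ideal)
  then have "lattice_ideal \<subseteq> a_kernel int_mpoly_ring \<Z> (mpoly_val \<phi>)"
    unfolding lattice_ideal_def
    by (rule ring.genideal_minimal[OF cring.axioms(1)[OF cring_int_mpoly_ring]])
       (auto simp: a_kernel_def' int_mpoly_ring_def assms(1-4))
  then show ?thesis
    using assms(5) by (auto simp: a_kernel_def')
qed

\<comment> \<open>A type in place of a record of cosets makes class-based arithmetic and
  simplification available in the quotient.\<close>
quotient_type (overloaded) 'x lattice_ring =
  "'x::bounded_lattice int_mpoly" / "\<lambda>p q. p - q \<in> lattice_ideal"
proof (rule equivpI)
  show "reflp (\<lambda>p q. p - q \<in> (lattice_ideal :: 'x int_mpoly set))"
    by (simp add: reflp_def lattice_ideal_0)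
  show "symp (\<lambda>p q. p - q \<in> (lattice_ideal :: 'x int_mpoly set))"
    using lattice_ideal_minus by (fastforce simp: symp_def)
  show "transp (\<lambda>p q. p - q \<in> (lattice_ideal :: 'x int_mpoly set))"
    using lattice_ideal_add by (fastforce simp: transp_def)
qed

text \<open>Not an instance of \<^class>\<open>comm_ring_1\<close>, which requires \<open>0 \<noteq> 1\<close>: the one-element lattice gives the
  zero ring.\<close>

instantiation lattice_ring :: (bounded_lattice) "{comm_ring, comm_monoid_mult}"
begin

lift_definition zero_lattice_ring :: "'a lattice_ring" is 0 .

lift_definition one_lattice_ring :: "'a lattice_ring" is 1 .

lift_definition plus_lattice_ring :: "'a lattice_ring \<Rightarrow> 'a lattice_ring \<Rightarrow> 'a lattice_ring" is "(+)"
  using lattice_ideal_add by (fastforce simp: algebra_simps)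

lift_definition uminus_lattice_ring :: "'a lattice_ring \<Rightarrow> 'a lattice_ring" is uminus
  using lattice_ideal_minus by fastforce

lift_definition minus_lattice_ring :: "'a lattice_ring \<Rightarrow> 'a lattice_ring \<Rightarrow> 'a lattice_ring" is "(-)"
proof -
  fix p p' q q' :: "'a int_mpoly"
  assume "p - p' \<in> lattice_ideal" "q - q' \<in> lattice_ideal"
  then have "(p - p') + - (q - q') \<in> lattice_ideal"
    by (intro lattice_ideal_add lattice_ideal_minus)
  then show "p - q - (p' - q') \<in> lattice_ideal"
    by (simp add: algebra_simps)
qed

lift_definition times_lattice_ring :: "'a lattice_ring \<Rightarrow> 'a lattice_ring \<Rightarrow> 'a lattice_ring" is "(*)"
proof -
  fix p p' q q' :: "'a int_mpoly"
  assume "p - p' \<in> lattice_ideal" "q - q' \<in> lattice_ideal"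
  then have "q * (p - p') + p' * (q - q') \<in> lattice_ideal"
    by (intro lattice_ideal_add lattice_ideal_mult)
  then show "p * q - p' * q' \<in> lattice_ideal"
    by (simp add: algebra_simps)
qed

instance
proof
  fix a b c :: "'a lattice_ring"
  show "a + b + c = a + (b + c)" by transfer (simp add: add.assoc lattice_ideal_0)
  show "a + b = b + a" by transfer (simp add: add.commute lattice_ideal_0)
  show "0 + a = a" by transfer (simp add: lattice_ideal_0)
  show "- a + a = 0" by transfer (simp add: lattice_ideal_0)
  show "a - b = a + - b" by transfer (simp add: lattice_ideal_0)
  show "a * b * c = a * (b * c)" by transfer (simp add: mult.assoc lattice_ideal_0)
  show "a * b = b * a" by transfer (simp add: mult.commute lattice_ideal_0)
  show "(a + b) * c = a * c + b * c" by transfer (simp add: distrib_right lattice_ideal_0)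
  show "1 * a = a" by transfer (simp add: lattice_ideal_0)
qed

end

section \<open>Generators, integer constants and the ring record of the quotient\<close>

lift_definition gen :: "'x::bounded_lattice \<Rightarrow> 'x lattice_ring" is Var .

text \<open>The canonical map from \<open>\<int>\<close>, in the role of \<open>of_int\<close>,
  whose class would demand \<open>0 \<noteq> 1\<close>.\<close>

lift_definition const :: "int \<Rightarrow> 'x::bounded_lattice lattice_ring" is of_int .

lemma gen_bot: "gen bot_class.bot = 0"
  by transfer (simp add: lattice_ideal_gens)

lemma gen_top: "gen top_class.top = 1"
  by transfer (rule lattice_ideal_gens)

lemma gen_inf: "gen (inf_class.inf x y) = gen x * gen y"
  by transfer (rule lattice_ideal_gens)

lemma gen_sup: "gen (sup_class.sup x y) = gen x + gen y - gen x * gen y"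
proof transfer
  fix x y :: 'a
  show "Var (sup_class.sup x y) - (Var x + Var y - Var x * Var y) \<in> lattice_ideal"
    using lattice_ideal_gens(4)[of x y] by (simp add: algebra_simps)
qed

lemma gen_idem: "gen x * gen x = gen x"
  using gen_inf[of x x] by simp

lemma const_simps [simp]: "const 0 = 0" "const 1 = 1"
  by (transfer, simp add: lattice_ideal_0)+

lemma const_ops: "const (a + b) = const a + const b" "const (a - b) = const a - const b"
  "const (a * b) = const a * const b"
  by (transfer, simp add: lattice_ideal_0)+

definition lattice_ring_ring :: "'x::bounded_lattice lattice_ring ring" where
  "lattice_ring_ring = \<lparr>carrier = UNIV, monoid.mult = (*), one = 1, zero = 0, add = (+)\<rparr>"

lemma lattice_ring_ring_simps [simp]:
  "carrier lattice_ring_ring = UNIV" "monoid.mult lattice_ring_ring = (*)"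
  "one lattice_ring_ring = 1" "zero lattice_ring_ring = 0" "add lattice_ring_ring = (+)"
  by (simp_all add: lattice_ring_ring_def)

lemma cring_lattice_ring_ring: "cring (lattice_ring_ring :: 'x::bounded_lattice lattice_ring ring)"
proof (rule cringI)
  show "abelian_group (lattice_ring_ring :: 'x lattice_ring ring)"
  proof (rule abelian_groupI)
    fix p :: "'x lattice_ring"
    show "\<exists>q\<in>carrier lattice_ring_ring. q \<oplus>\<^bsub>lattice_ring_ring\<^esub> p = \<zero>\<^bsub>lattice_ring_ring\<^esub>"
      by (rule bexI[of _ "- p"]) simp_all
  qed (auto simp: algebra_simps)
  show "comm_monoid (lattice_ring_ring :: 'x lattice_ring ring)"
    by (rule comm_monoidI) (auto simp: algebra_simps)
qed (auto simp: algebra_simps)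

text \<open>First isomorphism theorem for the projection, linking the coset ring to the quotient
  type.\<close>

lemma Quot_lattice_ideal_iso:
  "(int_mpoly_ring :: 'x int_mpoly ring) Quot lattice_ideal \<simeq>
    (lattice_ring_ring :: 'x::bounded_lattice lattice_ring ring)"
proof -
  let ?P = "int_mpoly_ring :: 'x int_mpoly ring" and ?abs = "abs_lattice_ring :: 'x int_mpoly \<Rightarrow> _"
  have "?abs \<in> ring_hom ?P lattice_ring_ring"
    by (rule ring_hom_memI)
       (simp_all add: int_mpoly_ring_def plus_lattice_ring.abs_eq times_lattice_ring.abs_eq
        one_lattice_ring_def)
  then have hom: "ring_hom_ring ?P lattice_ring_ring ?abs"
    by (rule ring_hom_ringI2[OF cring.axioms(1)[OF cring_int_mpoly_ring]
          cring.axioms(1)[OF cring_lattice_ring_ring]])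
  have ker: "a_kernel ?P lattice_ring_ring ?abs = lattice_ideal"
    by (auto simp: a_kernel_def' zero_lattice_ring_def lattice_ring.abs_eq_iff int_mpoly_ring_def)
  have "surj ?abs"
    by (rule surjI) (rule Quotient3_abs_rep[OF Quotient3_lattice_ring])
  then have "?abs ` carrier ?P = carrier lattice_ring_ring"
    by (simp add: int_mpoly_ring_def)
  from ring_hom_ring.FactRing_iso[OF hom this] show ?thesis
    unfolding ker .
qed

subsection \<open>Atomic idempotents and their characters\<close>

text \<open>Only the generators are tested for splitting \<open>f\<close>; by
  \<open>mult_atomic_idem\<close> this already forces every multiple of \<open>f\<close> to be an
  integer multiple.\<close>

definition atomic_idem :: "'x::bounded_lattice lattice_ring \<Rightarrow> bool" where
  "atomic_idem f \<longleftrightarrow> f \<noteq> 0 \<and> f * f = f \<and> (\<forall>x. gen x * f = 0 \<or> gen x * f = f)"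

definition orthogonal_atoms :: "'x::bounded_lattice lattice_ring set \<Rightarrow> bool" where
  "orthogonal_atoms F \<longleftrightarrow>
     finite F \<and> (\<forall>f\<in>F. atomic_idem f) \<and> (\<forall>f\<in>F. \<forall>g\<in>F. f \<noteq> g \<longrightarrow> f * g = 0)"

text \<open>Evaluation of a chosen representative; \<open>character_abs\<close> shows that the
  choice does not matter when \<open>f\<close> is atomic.\<close>

definition character :: "'x::bounded_lattice lattice_ring \<Rightarrow> 'x lattice_ring \<Rightarrow> int" where
  "character f q = mpoly_val (\<lambda>x. gen x * f = f) (rep_lattice_ring q)"

lemma character_abs:
  assumes "atomic_idem f"
  shows "character f (abs_lattice_ring p) = mpoly_val (\<lambda>x. gen x * f = f) p"
proof -
  let ?\<phi> = "\<lambda>x. gen x * f = f"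
  have f: "f \<noteq> 0" "\<And>x. gen x * f = 0 \<or> gen x * f = f"
    using assms by (auto simp: atomic_idem_def)
  have "abs_lattice_ring (rep_lattice_ring (abs_lattice_ring p)) = abs_lattice_ring p"
    by (rule Quotient3_abs_rep[OF Quotient3_lattice_ring])
  then have "rep_lattice_ring (abs_lattice_ring p) - p \<in> lattice_ideal"
    by (simp add: lattice_ring.abs_eq_iff)
  \<comment> \<open>Each generator acts on \<open>f\<close> as 0 or as the identity, so the inner
    product is again \<open>0\<close> or \<open>f\<close> and four cases decide the claim.\<close>
  moreover have "gen (inf_class.inf x y) * f = gen x * (gen y * f)" for x y
    by (simp add: gen_inf mult.assoc)
  then have "?\<phi> (inf_class.inf x y) \<longleftrightarrow> ?\<phi> x \<and> ?\<phi> y" for x y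
    using f(1) f(2)[of x] f(2)[of y] by auto
  moreover have "gen (sup_class.sup x y) * f = gen x * f + gen y * f - gen x * (gen y * f)" for x y
    by (simp add: gen_sup algebra_simps)
  then have "?\<phi> (sup_class.sup x y) \<longleftrightarrow> ?\<phi> x \<or> ?\<phi> y" for x y
    using f(1) f(2)[of x] f(2)[of y] by auto
  \<comment> \<open>Here \<open>f \<noteq> 0\<close> is what makes the point false at the bottom
    element, as \<open>gen bot * f = 0\<close>.\<close>
  ultimately have "mpoly_val ?\<phi> (rep_lattice_ring (abs_lattice_ring p) - p) = 0"
    using f(1) by (intro mpoly_val_lattice_ideal) (simp_all add: gen_bot gen_top)
  then show ?thesis
    by (simp add: character_def)
qed

lemma character_add:
  assumes "atomic_idem f"
  shows "character f (q + r) = character f q + character f r"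
  by (induction q rule: lattice_ring.abs_induct, induction r rule: lattice_ring.abs_induct)
     (simp add: plus_lattice_ring.abs_eq character_abs[OF assms])

lemma character_mult:
  assumes "atomic_idem f"
  shows "character f (q * r) = character f q * character f r"
  by (induction q rule: lattice_ring.abs_induct, induction r rule: lattice_ring.abs_induct)
     (simp add: times_lattice_ring.abs_eq character_abs[OF assms])

lemma character_0: "atomic_idem f \<Longrightarrow> character f 0 = 0"
  by (simp add: zero_lattice_ring_def character_abs)

lemma character_1: "atomic_idem f \<Longrightarrow> character f 1 = 1"
  by (simp add: one_lattice_ring_def character_abs)

lemma character_const: "atomic_idem f \<Longrightarrow> character f (const k) = k"
  by (simp add: const.abs_eq character_abs)

lemma character_sum:
  assumes "atomic_idem f"
  shows "character f (\<Sum>i\<in>A. q i) = (\<Sum>i\<in>A. character f (q i))"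
  by (induction A rule: infinite_finite_induct)
     (simp_all add: character_0 character_add assms)

text \<open>Both sides are additive in \<open>q\<close>, which leaves monomials; these are handled
  one variable at a time, each variable acting on \<open>f\<close> as the scalar 0 or 1.\<close>

lemma mult_atomic_idem:
  assumes "atomic_idem f"
  shows "q * f = const (character f q) * f"
proof (induction q rule: lattice_ring.abs_induct)
  case (1 p)
  let ?\<phi> = "\<lambda>x. gen x * f = f"
  have "abs_lattice_ring p * f = const (mpoly_val ?\<phi> p) * f"
    using subset_UNIV
  proof (induction p rule: frag_induction)
    case zero
    then show ?case by (simp flip: zero_lattice_ring_def)
  next
    case (one m)
    show ?case
    proof (induction m rule: monomial_induct)
      case zero
      then show ?case
        by (simp add: monomial_val_def flip: one_lattice_ring_def)
    next
      case (Var x m)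
      have "frag_of (Poly_Mapping.single x 1 + m) = Var x * frag_of m"
        by (simp add: Var_def mult_single)
      then have "abs_lattice_ring (frag_of (Poly_Mapping.single x 1 + m))
          = gen x * abs_lattice_ring (frag_of m)"
        by (simp add: times_lattice_ring.abs_eq gen.abs_eq)
      then have "abs_lattice_ring (frag_of (Poly_Mapping.single x 1 + m)) * f
          = gen x * (const (monomial_val ?\<phi> m) * f)"
        using Var.IH by (simp add: mult.assoc)
      also have "\<dots> = const (monomial_val ?\<phi> m) * (gen x * f)"
        by (simp add: mult.left_commute)
      also have "gen x * f = const (of_bool (?\<phi> x)) * f"
        using assms by (auto simp: atomic_idem_def)
      also have "of_bool (?\<phi> x) = monomial_val ?\<phi> (Poly_Mapping.single x 1)"
        by (simp add: monomial_val_def)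
      finally show ?case
        by (simp add: monomial_val_add const_ops algebra_simps)
    qed
  next
    case (diff a b)
    have "abs_lattice_ring (a - b) = abs_lattice_ring a - abs_lattice_ring b"
      by (simp add: minus_lattice_ring.abs_eq)
    then show ?case
      using diff by (simp add: const_ops left_diff_distrib)
  qed
  then show ?case
    by (simp add: character_abs assms)
qed

text \<open>The value is an idempotent integer, and 0 is excluded because \<open>f\<close> equals
  that multiple of itself and is nonzero.\<close>

lemma character_self:
  assumes "atomic_idem f"
  shows "character f f = 1"
proof -
  have "character f f * character f f = character f f"
    using assms by (metis atomic_idem_def character_mult)
  moreover have "f \<noteq> 0" "f = const (character f f) * f"
    using assms mult_atomic_idem[OF assms, of f] by (auto simp: atomic_idem_def)
  then have "character f f \<noteq> 0"
    by auto
  ultimately show ?thesis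
    by simp
qed

lemma character_orthogonal:
  assumes "atomic_idem f" "f * g = 0"
  shows "character f g = 0"
  using assms character_mult[of f f g] by (simp add: character_self character_0)

subsection \<open>Decomposition into atomic idempotents\<close>

text \<open>The relation \<open>r\<close> is left abstract so that one splitting argument serves
  both termination proofs.\<close>

lemma idempotent_decomposition:
  fixes f :: "'x::bounded_lattice lattice_ring" and r :: "'x lattice_ring rel"
  assumes "wf r"
    and less: "\<And>f x. f * f = f \<Longrightarrow> gen x * f \<noteq> 0 \<Longrightarrow> gen x * f \<noteq> f \<Longrightarrow>
      (gen x * f, f) \<in> r \<and> (f - gen x * f, f) \<in> r"
    and "f * f = f"
  shows "\<exists>F. orthogonal_atoms F \<and> \<Sum>F = f"
  using assms(1,3)
proof (induction f rule: wf_induct_rule)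
  case (less f)
  consider "f = 0" | "atomic_idem f" | x where "gen x * f \<noteq> 0" "gen x * f \<noteq> f"
    using less.prems by (auto simp: atomic_idem_def)
  then show ?case
  proof cases
    case 1
    then show ?thesis by (intro exI[of _ "{}"]) (simp add: orthogonal_atoms_def)
  next
    case 2
    then show ?thesis by (intro exI[of _ "{f}"]) (simp add: orthogonal_atoms_def)
  next
    case 3
    define g where "g = gen x * f"
    have gf: "g * f = g"
      using less.prems by (simp add: g_def mult.assoc)
    have gg: "g * g = g"
    proof -
      have "g * g = (gen x * gen x) * (f * f)"
        by (simp add: g_def algebra_simps)
      then show ?thesis
        using less.prems by (simp add: gen_idem g_def)
    qed
    have hh: "(f - g) * (f - g) = f - g"
      using gf gg less.prems by (simp add: algebra_simps)
    obtain F where F: "orthogonal_atoms F" "\<Sum>F = g"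
      using less.IH[OF _ gg] assms(2)[OF less.prems 3] unfolding g_def by blast
    obtain G where G: "orthogonal_atoms G" "\<Sum>G = f - g"
      using less.IH[OF _ hh] assms(2)[OF less.prems 3] unfolding g_def by blast
    \<comment> \<open>Cross terms vanish by orthogonality, leaving only
      \<open>a * a = a\<close>.\<close>
    have absorb: "a * \<Sum>H = a" if "orthogonal_atoms H" "a \<in> H" for a and H :: "'x lattice_ring set"
    proof -
      have "a * \<Sum>H = (\<Sum>b\<in>H. if b = a then a else 0)"
        using that unfolding sum_distrib_left orthogonal_atoms_def
        by (intro sum.cong) (auto simp: atomic_idem_def)
      then show ?thesis
        using that by (simp add: orthogonal_atoms_def)
    qed
    \<comment> \<open>By absorption \<open>a\<close> is a multiple of \<open>g\<close> and
      \<open>b\<close> of \<open>f - g\<close>, and \<open>g * (f - g) = 0\<close>.\<close>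
    have zero: "a * b = 0" if "a \<in> F" "b \<in> G" for a b
    proof -
      have "a * b = (a * g) * (b * (f - g))"
        using absorb[OF F(1) that(1)] absorb[OF G(1) that(2)] F(2) G(2) by simp
      also have "\<dots> = a * b * (g * (f - g))"
        by (simp add: algebra_simps)
      finally show ?thesis
        using gf gg by (simp add: right_diff_distrib)
    qed
    then have zero': "b * a = 0" if "a \<in> F" "b \<in> G" for a b
      using that by (simp add: mult.commute)
    \<comment> \<open>A common element would satisfy \<open>a = a * a = 0\<close>. Disjointness lets
      the two sums be added.\<close>
    have "F \<inter> G = {}"
      using zero F(1) by (fastforce simp: orthogonal_atoms_def atomic_idem_def)
    then have "\<Sum>(F \<union> G) = f"
      using F G by (simp add: orthogonal_atoms_def sum.union_disjoint)
    moreover have "orthogonal_atoms (F \<union> G)"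
      using F(1) G(1) by (auto simp: orthogonal_atoms_def zero zero')
    ultimately show ?thesis by blast
  qed
qed

lemma noetherian_decomposition:
  assumes "noetherian_ring (lattice_ring_ring :: 'x::bounded_lattice lattice_ring ring)"
  shows "\<exists>F :: 'x lattice_ring set. orthogonal_atoms F \<and> \<Sum>F = 1"
proof -
  interpret noetherian_ring "lattice_ring_ring :: 'x lattice_ring ring" by fact
  define ann where "ann f = {q. q * f = 0}" for f :: "'x lattice_ring"
  have ideal: "ideal (ann f) lattice_ring_ring" for f :: "'x lattice_ring"
  proof (rule idealI)
    show "subgroup (ann f) (add_monoid lattice_ring_ring)"
    proof (rule add.subgroupI)
      show "\<ominus>\<^bsub>lattice_ring_ring\<^esub> a \<in> ann f" if "a \<in> ann f" for a
      proof -
        have "\<ominus>\<^bsub>lattice_ring_ring\<^esub> a = - a"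
          by (rule minus_equality) simp_all
        then show ?thesis using that by (simp add: ann_def)
      qed
    qed (auto simp: ann_def algebra_simps intro: exI[of _ 0])
    fix a x assume "a \<in> ann f"
    then have "x * a * f = 0"
      by (simp add: ann_def mult.assoc)
    then show "x \<otimes>\<^bsub>lattice_ring_ring\<^esub> a \<in> ann f" "a \<otimes>\<^bsub>lattice_ring_ring\<^esub> x \<in> ann f"
      by (simp_all add: ann_def mult.commute)
  qed (rule local.ring_axioms)
  \<comment> \<open>The element \<open>f - g\<close> witnesses strictness: it kills
    \<open>g\<close>, but its product with \<open>f\<close> is \<open>f - g\<close> itself, which is
    nonzero.\<close>
  have strict: "ann f \<subset> ann g" if "f * g = g" "g * g = g" "f * f = f" "g \<noteq> f"
    for f g :: "'x lattice_ring"
  proof -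
    have "ann f \<subseteq> ann g"
    proof
      fix q assume "q \<in> ann f"
      then have "q * f * g = 0" by (simp add: ann_def)
      then show "q \<in> ann g" by (simp add: ann_def mult.assoc that(1))
    qed
    moreover have "f - g \<in> ann g" "f - g \<notin> ann f"
      using that mult.commute[of g f] by (simp_all add: ann_def left_diff_distrib)
    ultimately show ?thesis by blast
  qed
  show ?thesis
  proof (rule idempotent_decomposition)
    show "wf (inv_image {(J, K). ideal J lattice_ring_ring \<and> ideal K lattice_ring_ring \<and> K \<subset> J} ann)"
      by (rule wf_inv_image) (rule wf_ideals_supset)
    fix f :: "'x lattice_ring" and x
    assume f: "f * f = f" "gen x * f \<noteq> 0" "gen x * f \<noteq> f"
    have 1: "f * (gen x * f) = gen x * f"
      using f(1) by (simp add: mult.left_commute[of f])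
    have 2: "(gen x * f) * (gen x * f) = gen x * f"
      using 1 by (simp add: mult.assoc gen_idem flip: mult.assoc[of "gen x" "gen x"])
    have "ann f \<subset> ann (gen x * f)"
      by (rule strict) (use 1 2 f in simp_all)
    moreover have "ann f \<subset> ann (f - gen x * f)"
      by (rule strict)
         (use 1 2 f mult.commute[of "gen x * f" f] in
          \<open>simp_all add: left_diff_distrib right_diff_distrib\<close>)
    ultimately show "(gen x * f, f) \<in> inv_image {(J, K). ideal J lattice_ring_ring \<and>
        ideal K lattice_ring_ring \<and> K \<subset> J} ann \<and>
      (f - gen x * f, f) \<in> inv_image {(J, K). ideal J lattice_ring_ring \<and>
        ideal K lattice_ring_ring \<and> K \<subset> J} ann"
      by (simp add: ideal)
  qed simp
qed

text \<open>Noetherianity is to be derived here, so termination comes from counting the lattice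
  elements that still split \<open>f\<close>.\<close>

lemma finite_decomposition:
  assumes fin: "finite (UNIV :: 'x::bounded_lattice set)"
  shows "\<exists>F :: 'x lattice_ring set. orthogonal_atoms F \<and> \<Sum>F = 1"
proof (rule idempotent_decomposition)
  define U where "U f = {x. gen x * f \<noteq> 0 \<and> gen x * f \<noteq> f}" for f :: "'x lattice_ring"
  show "wf (measure (\<lambda>f. card (U f)))" by simp
  fix f :: "'x lattice_ring" and x
  assume f: "f * f = f" "gen x * f \<noteq> 0" "gen x * f \<noteq> f"
  have x: "gen x * (gen x * f) = gen x * f"
    by (simp add: gen_idem flip: mult.assoc)
  have comm: "gen y * (gen x * f) = gen x * (gen y * f)" for y
    by (rule mult.left_commute)
  \<comment> \<open>\<open>gen x\<close> acts as the identity on one part and as 0 on the other, so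
    \<open>x\<close> splits neither.\<close>
  have "x \<in> U f" "x \<notin> U (gen x * f)" "x \<notin> U (f - gen x * f)"
    using f x by (simp_all add: U_def right_diff_distrib)
  \<comment> \<open>No new splitting element appears: if \<open>gen y\<close> kills or fixes
    \<open>f\<close>, it does the same to both parts, by commutativity.\<close>
  moreover have "U (gen x * f) \<subseteq> U f" "U (f - gen x * f) \<subseteq> U f"
    by (auto simp: U_def right_diff_distrib comm)
  ultimately have "U (gen x * f) \<subset> U f" "U (f - gen x * f) \<subset> U f"
    by blast+
  then show "(gen x * f, f) \<in> measure (\<lambda>f. card (U f)) \<and>
      (f - gen x * f, f) \<in> measure (\<lambda>f. card (U f))"
    using fin by (auto intro!: psubset_card_mono intro: finite_subset[OF subset_UNIV])
qed simp

section \<open>Consequences of a decomposition: Noetherianity and the coordinate isomorphism\<close>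

lemma decomposition_imp_noetherian:
  fixes F :: "'x::bounded_lattice lattice_ring set"
  assumes F: "orthogonal_atoms F" "\<Sum>F = 1"
  shows "noetherian_ring (lattice_ring_ring :: 'x lattice_ring ring)"
proof -
  interpret R: cring "lattice_ring_ring :: 'x lattice_ring ring"
    by (rule cring_lattice_ring_ring)
  have minus: "\<ominus>\<^bsub>lattice_ring_ring\<^esub> a = - a" for a :: "'x lattice_ring"
    by (rule R.minus_equality) simp_all
  show ?thesis
  proof (rule R.noetherian_ringI)
    fix J :: "'x lattice_ring set" assume "ideal J lattice_ring_ring"
    then interpret J: ideal J lattice_ring_ring .
    have J0: "0 \<in> J" and Jadd: "\<And>a b. a \<in> J \<Longrightarrow> b \<in> J \<Longrightarrow> a + b \<in> J"
      and Jmult: "\<And>a b. a \<in> J \<Longrightarrow> b * a \<in> J" and Jminus: "\<And>a. a \<in> J \<Longrightarrow> - a \<in> J"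
      using J.zero_closed J.a_closed J.I_l_closed J.a_inv_closed by (auto simp: minus)
    \<comment> \<open>The integers \<open>k\<close> with \<open>const k * f\<close> in
      \<open>J\<close> form an ideal of \<open>\<int>\<close>; its generator is
      \<open>d\<close>.\<close>
    have "\<exists>d. const d * f \<in> J \<and> (\<forall>k. const k * f \<in> J \<longrightarrow> d dvd k)" for f
    proof -
      obtain d where "d \<in> {k. const k * f \<in> J}" "\<And>k. k \<in> {k. const k * f \<in> J} \<Longrightarrow> d dvd k"
      proof (rule int_ideal_principal[of "{k. const k * f \<in> J}"])
        fix a b assume "a \<in> {k. const k * f \<in> J}" "b \<in> {k. const k * f \<in> J}"
        then show "a - b \<in> {k. const k * f \<in> J}"
          using Jadd[OF _ Jminus] by (auto simp: const_ops left_diff_distrib)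
      qed (auto simp: const_ops mult.assoc J0 Jmult)
      then show ?thesis by blast
    qed
    then obtain d where d: "\<And>f. const (d f) * f \<in> J" "\<And>f k. const k * f \<in> J \<Longrightarrow> d f dvd k"
      by metis
    define A where "A = (\<lambda>f. const (d f) * f) ` F"
    interpret I: ideal "Idl\<^bsub>lattice_ring_ring\<^esub> A" lattice_ring_ring
      by (rule R.genideal_ideal) simp
    have AI: "A \<subseteq> Idl\<^bsub>lattice_ring_ring\<^esub> A"
      by (rule R.genideal_self) simp
    have "J \<subseteq> Idl\<^bsub>lattice_ring_ring\<^esub> A"
    proof
      fix q assume q: "q \<in> J"
      have "q * f \<in> Idl\<^bsub>lattice_ring_ring\<^esub> A" if f: "f \<in> F" for f
      proof -
        have qf: "q * f = const (character f q) * f"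
          using mult_atomic_idem F f by (auto simp: orthogonal_atoms_def)
        \<comment> \<open>Since \<open>q * f\<close> lies in \<open>J\<close>, its integer
          coefficient is divisible by \<open>d f\<close>.\<close>
        then have "const (character f q) * f \<in> J"
          using Jmult[OF q, of f] by (simp add: mult.commute)
        then obtain c where "character f q = c * d f"
          using d(2) by (metis dvdE mult.commute)
        then have "q * f = const c * (const (d f) * f)"
          using qf by (simp add: const_ops mult.assoc)
        moreover have "const (d f) * f \<in> Idl\<^bsub>lattice_ring_ring\<^esub> A"
          using AI f by (auto simp: A_def)
        ultimately show ?thesis
          using I.I_l_closed by simp
      qed
      then have "(\<Sum>f\<in>G. q * f) \<in> Idl\<^bsub>lattice_ring_ring\<^esub> A" if "G \<subseteq> F" for G
        using that I.zero_closed I.a_closed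
        by (induction G rule: infinite_finite_induct) auto
      \<comment> \<open>As \<open>\<Sum>F = 1\<close>, this product is \<open>q\<close>.\<close>
      then have "q * \<Sum>F \<in> Idl\<^bsub>lattice_ring_ring\<^esub> A"
        by (simp add: sum_distrib_left)
      then show "q \<in> Idl\<^bsub>lattice_ring_ring\<^esub> A"
        using F by simp
    qed
    moreover have "Idl\<^bsub>lattice_ring_ring\<^esub> A \<subseteq> J"
      using d(1) by (intro R.genideal_minimal J.is_ideal) (auto simp: A_def)
    ultimately show "\<exists>A\<subseteq>carrier lattice_ring_ring. finite A \<and> J = Idl\<^bsub>lattice_ring_ring\<^esub> A"
      using F(1) by (intro exI[of _ A]) (auto simp: A_def orthogonal_atoms_def)
  qed
qed

text \<open>An element is recovered from its characters, giving injectivity; orthogonality gives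
  surjectivity. An empty \<open>F\<close> forces \<open>1 = 0\<close> and yields the zero
  ring.\<close>

lemma decomposition_imp_iso:
  fixes F :: "'x::bounded_lattice lattice_ring set"
  assumes F: "orthogonal_atoms F" "\<Sum>F = 1"
  shows "(lattice_ring_ring :: 'x lattice_ring ring) \<simeq> int_power_ring (card F)"
proof -
  have "finite F"
    using F(1) by (simp add: orthogonal_atoms_def)
  \<comment> \<open>The enumeration fixes an order of coordinates; distinctness makes its length
    \<open>card F\<close>.\<close>
  then obtain fs where fs: "set fs = F" "distinct fs"
    using finite_distinct_list by blast
  have atom: "atomic_idem f" if "f \<in> F" for f
    using that F(1) by (simp add: orthogonal_atoms_def)
  have len: "length fs = card F"
    using fs distinct_card by fastforce
  define h where "h q = map (\<lambda>f. character f q) fs" for q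
  have expand: "q = (\<Sum>f\<in>F. const (character f q) * f)" for q
  proof -
    have "q = q * \<Sum>F" using F by simp
    also have "\<dots> = (\<Sum>f\<in>F. const (character f q) * f)"
      unfolding sum_distrib_left by (intro sum.cong refl mult_atomic_idem atom)
    finally show ?thesis .
  qed
  have "h \<in> ring_iso lattice_ring_ring (int_power_ring (card F))"
  proof (rule ring_iso_memI)
    fix q r :: "'x lattice_ring"
    show "h q \<in> carrier (int_power_ring (card F))"
      by (simp add: carrier_int_power_ring h_def len)
    show "h (q \<otimes>\<^bsub>lattice_ring_ring\<^esub> r) = h q \<otimes>\<^bsub>int_power_ring (card F)\<^esub> h r"
      using len fs atom
      by (simp add: h_def int_power_ring_coordinatewise character_mult map2_map_map)
    show "h (q \<oplus>\<^bsub>lattice_ring_ring\<^esub> r) = h q \<oplus>\<^bsub>int_power_ring (card F)\<^esub> h r"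
      using len fs atom
      by (simp add: h_def int_power_ring_coordinatewise character_add map2_map_map)
  next
    show "h \<one>\<^bsub>lattice_ring_ring\<^esub> = \<one>\<^bsub>int_power_ring (card F)\<^esub>"
      using len fs atom
      by (intro nth_equalityI) (auto simp: h_def one_int_power_ring character_1)
  next
    show "bij_betw h (carrier lattice_ring_ring) (carrier (int_power_ring (card F)))"
      unfolding bij_betw_def
    proof
      show "inj_on h (carrier lattice_ring_ring)"
      proof (rule inj_onI)
        fix q r assume "h q = h r"
        then have "character f q = character f r" if "f \<in> F" for f
          using that fs by (simp add: h_def)
        then show "q = r"
          by (subst (1 2) expand) (simp cong: sum.cong)
      qed
      show "h ` carrier lattice_ring_ring = carrier (int_power_ring (card F))"
      proof
        show "h ` carrier lattice_ring_ring \<subseteq> carrier (int_power_ring (card F))"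
          by (auto simp: carrier_int_power_ring h_def len)
        show "carrier (int_power_ring (card F)) \<subseteq> h ` carrier lattice_ring_ring"
        proof
          fix as assume "as \<in> carrier (int_power_ring (card F))"
          then have as: "length as = length fs"
            by (simp add: carrier_int_power_ring len)
          \<comment> \<open>The preimage uses the list entries as integer coefficients; the
            characters of the atoms form a Kronecker delta and read them off.\<close>
          define q where "q = (\<Sum>i<length fs. const (as ! i) * fs ! i)"
          have "character (fs ! j) q = as ! j" if j: "j < length fs" for j
          proof -
            have fj: "atomic_idem (fs ! j)"
              using atom fs j by auto
            have "character (fs ! j) (fs ! i) = of_bool (i = j)" if "i < length fs" for i
            proof (cases "i = j")
              case False
              then have "fs ! j * fs ! i = 0"
                using F(1) fs j that by (auto simp: orthogonal_atoms_def nth_eq_iff_index_eq)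
              then show ?thesis
                using False fj by (simp add: character_orthogonal)
            qed (use fj character_self in simp)
            then have "character (fs ! j) q = (\<Sum>i<length fs. as ! i * of_bool (i = j))"
              unfolding q_def character_sum[OF fj]
              by (intro sum.cong) (simp_all add: character_mult character_const fj)
            also have "\<dots> = (\<Sum>i<length fs. if i = j then as ! i else 0)"
              by (intro sum.cong) auto
            finally show ?thesis
              using j by simp
          qed
          then have "h q = as"
            using as by (intro nth_equalityI) (simp_all add: h_def)
          then show "as \<in> h ` carrier lattice_ring_ring"
            by auto
        qed
      qed
    qed
  qed
  then show ?thesis
    unfolding is_ring_iso_def by blast
qed

theorem theorem3:
  fixes R :: "'x::bounded_lattice int_mpoly set ring"
  assumes "R = int_mpoly_ring Quot lattice_ideal"
  shows "(noetherian_ring R \<longrightarrow> (\<exists>n. R \<simeq> int_power_ring n)) \<and>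
         (finite (UNIV :: 'x set) \<longrightarrow> noetherian_ring R)"
proof (intro conjI impI)
  let ?Q = "lattice_ring_ring :: 'x lattice_ring ring"
  \<comment> \<open>The results hold for the type-based copy; this isomorphism carries Noetherianity
    in either direction.\<close>
  have iso: "R \<simeq> ?Q"
    unfolding assms by (rule Quot_lattice_ideal_iso)
  have Q: "ring ?Q"
    by (intro cring.axioms(1) cring_lattice_ring_ring)
  have R: "ring R"
    unfolding assms by (rule ideal.quotient_is_ring[OF ideal_lattice_ideal])
  show "\<exists>n. R \<simeq> int_power_ring n" if "noetherian_ring R"
    using noetherian_decomposition[OF noetherian_ring_iso[OF that Q iso]] decomposition_imp_iso
      ring_iso_trans[OF iso] by blast
  show "noetherian_ring R" if "finite (UNIV :: 'x set)"
    using finite_decomposition[OF that] decomposition_imp_noetherian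
      noetherian_ring_iso[OF _ R ring_iso_sym[OF R iso]] by blast
qed

end
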